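(* Let $t\ge3$, $n=2t$, let $\xi,\eta\in\mathbb{F}_{q^n}\setminus\mathbb{F}_{q^t}$ with $\xi^2=a\xi+b$ ($a,b\in\mathbb{F}_{q^t}$). Let $\mu_1,\mu_2\in\mathbb{F}_{q^t}^*$ with $\mathrm{N}_{q^t/q}(\mu_i)\ne1$ for $i=1,2$, $\mathrm{N}_{q^t/q}(-\xi^{q^t+1}\mu_1)\ne(-1)^t$ and $\mathrm{N}_{q^t/q}(-\eta^{q^t+1}\mu_2)\ne(-1)^t$, and let $s,s'$ be positive integers coprime with $t$. Let \[U=S_{x^{q^s},\xi}\times T_{\mu_1x^{q^s},\xi},\qquad U'=S_{x^{q^{s'}},\eta}\times T_{\mu_2x^{q^{s'}},\eta}.\] For $\sigma\in\mathrm{Aut}(\mathbb{F}_{q^n})$ write $\eta^\sigma=A\xi+B$ with $A,B\in\mathbb{F}_{q^t}$. Then $U$ and $U'$ are $\Gamma\mathrm{L}(2,q^n)$-equivalent through a map $\varphi\in\Gamma\mathrm{L}(2,q^n)$ with companion automorphism $\sigma$ if and only if one of the following holds: (I) $s\equiv -s'\pmod t$, $\xi=\frac{\eta^\sigma+Aa}{A}$, $B=-Aa$, and either (I.1) $\mu_2=\frac{1}{c_1A^{\sigma^{-1}}b^{\sigma^{-1}}}$ and $\mu_1=\frac{1}{c_2A^{q^s}b^{q^s}}$ for some $c_1,c_2\in\mathbb{F}_{q^t}$ with $\mathrm{N}_{q^t/q}(c_1)=\mathrm{N}_{q^t/q}(c_2)=1$, or (I.2) $\mathrm{N}_{q^t/q}(Ab)=1$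 and $\mu_2=\frac{1}{c\,\mu_1^{q^{-s}\sigma^{-1}}}$ for some $c\in\mathbb{F}_{q^t}$ with $\mathrm{N}_{q^t/q}(c)=1$; (II) $s\equiv s'\pmod t$, $\xi=\frac{\eta^\sigma}{A}$, $B=0$, and either (II.1) $\mu_2=\frac{c_1}{A^{\sigma^{-1}}}$ and $\mu_1=\frac{A}{c_2}$ for some $c_1,c_2\in\mathbb{F}_{q^t}$ with $\mathrm{N}_{q^t/q}(c_1)=\mathrm{N}_{q^t/q}(c_2)=1$, or (II.2) $\mathrm{N}_{q^t/q}(A)=1$ and $\mu_2=\frac{\mu_1^{\sigma^{-1}}c}{A^{\sigma^{-1}}}$ for some $c\in\mathbb{F}_{q^t}$ with $\mathrm{N}_{q^t/q}(c)=1$.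
   Context: For $\zeta\in\mathbb{F}_{q^{2t}}$ and a $q$-polynomial $h$ over $\mathbb{F}_{q^t}$, $S_{h,\zeta}=T_{h,\zeta}=\{u+\zeta h(u)\colon u\in\mathbb{F}_{q^t}\}\subseteq\mathbb{F}_{q^{2t}}$ (an $\mathbb{F}_q$-subspace); thus $S_{x^{q^s},\xi}=\{u+\xi u^{q^s}\}$ and $T_{\mu x^{q^s},\xi}=\{u+\xi\mu u^{q^s}\}$. $\mathrm{N}_{q^t/q}$ is the norm from $\mathbb{F}_{q^t}$ to $\mathbb{F}_q$. An element of $\Gamma\mathrm{L}(2,q^n)$ is an invertible semilinear map $\mathbf v\mapsto M\mathbf v^\sigma$ of $\mathbb{F}_{q^n}^2$, with companion automorphism $\sigma$; two subspaces are equivalent through it if it maps one onto the other. *)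

theory Defs
  imports
    "HOL-Analysis.Analysis"
    "HOL-Number_Theory.Prime_Powers"
    "HOL-Number_Theory.Cong"
begin

(* The ambient field F_{q^n} is a finite field type 'a with CARD('a) = q^n.
   It has exactly one subfield of order q^m for each divisor m of n, namely the
   set of roots of x^(q^m) - x. *)
definition subfield_of_order :: "nat \<Rightarrow> 'a::{finite,field} set" where
  "subfield_of_order k = {x. x ^ k = x}"

(* The norm N_{q^t/q}(x) = x^(1 + q + ... + q^(t-1)), meant for x in F_{q^t}: the
   conjugates of x over F_q are its images under the powers of the q-Frobenius. *)
definition field_norm :: "nat \<Rightarrow> nat \<Rightarrow> 'a::{finite,field} \<Rightarrow> 'a" where
  "field_norm q t x = (\<Prod>i<t. x ^ (q ^ i))"

definition field_automorphism :: "('a::field \<Rightarrow> 'a) \<Rightarrow> bool" where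
  "field_automorphism \<sigma> \<longleftrightarrow>
     bij \<sigma> \<and> \<sigma> 1 = 1 \<and>
     (\<forall>x y. \<sigma> (x + y) = \<sigma> x + \<sigma> y) \<and>
     (\<forall>x y. \<sigma> (x * y) = \<sigma> x * \<sigma> y)"

(* The set S_{h,zeta} (also written T_{h,zeta}), where K is F_{q^t}; the q-polynomial h
   is given by the function it induces. *)
definition poly_subspace :: "'a::field set \<Rightarrow> ('a \<Rightarrow> 'a) \<Rightarrow> 'a \<Rightarrow> 'a set" where
  "poly_subspace K h \<zeta> = {u + \<zeta> * h u | u. u \<in> K}"

definition plane_product :: "'a set \<Rightarrow> 'a set \<Rightarrow> ('a^2) set" where
  "plane_product S T = {v. v $ 1 \<in> S \<and> v $ 2 \<in> T}"

definition GammaL2 :: "('a::field \<Rightarrow> 'a) \<Rightarrow> ('a^2 \<Rightarrow> 'a^2) \<Rightarrow> bool" where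
  "GammaL2 \<sigma> \<phi> \<longleftrightarrow>
     field_automorphism \<sigma> \<and>
     (\<exists>M :: 'a^2^2. invertible M \<and> \<phi> = (\<lambda>v. M *v (\<chi> i. \<sigma> (v $ i))))"

end

theory Submission
  imports Defs
begin

text \<open>Both factors of \<open>U\<close> and \<open>U'\<close> have the same size and contain \<open>0\<close>, so an equivalence of the
  products amounts to scalar equivalences \<open>\<alpha> \<sigma>(S') \<subseteq> S\<close> of the factors, matched either in order or
  crosswise. Writing \<open>\<alpha> = x + \<xi> y\<close> with \<open>x, y\<close> in \<open>F_{q^t}\<close>, such an inclusion is an identity between
  linearized polynomials of degree less than \<open>q^t\<close> on \<open>F_{q^t}\<close>. Comparing coefficients forces
  \<open>y = 0\<close> (when \<open>s\<close> and \<open>s'\<close> are congruent modulo \<open>t\<close>) or \<open>x = 0\<close> (when \<open>s\<close> and \<open>- s'\<close> are), and leaves one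
  equation of the form \<open>x = z x^(q^s)\<close>, which by Hilbert's Theorem 90 is solvable exactly
  if \<open>z\<close> has norm \<open>1\<close>.\<close>

section \<open>Finite fields and their automorphisms\<close>

lemma finite_field_power_card:
  fixes x :: "'a::{finite,field}"
  shows "x ^ CARD('a) = x"
proof (cases "x = 0")
  case False
  let ?P = "\<Prod>y\<in>UNIV - {0::'a}. y"
  have "bij_betw ((*) x) (UNIV - {0}) (UNIV - {0})"
    using False by (intro bij_betw_byWitness[where f' = "\<lambda>y. y / x"]) auto
  \<comment> \<open>Multiplication by \<open>x\<close> permutes the nonzero elements, so it leaves
    their product unchanged.\<close>
  from prod.reindex_bij_betw[OF this, of "\<lambda>y. y"]
  have "x ^ card (UNIV - {0::'a}) * ?P = 1 * ?P"
    by (simp add: prod.distrib)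
  then have "x ^ card (UNIV - {0::'a}) = 1"
    by (subst (asm) mult_cancel_right) (simp add: prod_zero_iff)
  moreover have "CARD('a) = Suc (card (UNIV - {0::'a}))"
    by (rule card_Suc_Diff1[symmetric]) simp_all
  ultimately show ?thesis
    by (simp only: power_Suc mult_1_right)
qed (simp add: power_0_left)

lemma field_automorphism_simps:
  assumes "field_automorphism \<sigma>"
  shows "\<sigma> 0 = 0" "\<sigma> 1 = 1" "\<sigma> (x + y) = \<sigma> x + \<sigma> y" "\<sigma> (x * y) = \<sigma> x * \<sigma> y"
    and "\<sigma> (x ^ m) = \<sigma> x ^ m" "\<sigma> (x / y) = \<sigma> x / \<sigma> y" "\<sigma> x = \<sigma> y \<longleftrightarrow> x = y"
proof -
  show add: "\<sigma> (x + y) = \<sigma> x + \<sigma> y" and one: "\<sigma> 1 = 1"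
    and mult: "\<sigma> (x * y) = \<sigma> x * \<sigma> y" and inj: "\<sigma> x = \<sigma> y \<longleftrightarrow> x = y" for x y
    using assms by (auto simp: field_automorphism_def bij_def inj_eq)
  show zero: "\<sigma> 0 = 0"
    using add[of 0 0] by (metis add_cancel_right_left add_0)
  show "\<sigma> (x ^ m) = \<sigma> x ^ m"
    by (induction m) (simp_all add: one mult)
  show "\<sigma> (x / y) = \<sigma> x / \<sigma> y"
  proof (cases "y = 0")
    case False
    then have "\<sigma> (x / y) * \<sigma> y = \<sigma> x"
      by (simp flip: mult)
    then show ?thesis
      using False inj[of y 0] by (simp add: zero field_simps)
  qed (simp add: zero)
qed

lemma field_automorphism_inv:
  assumes "field_automorphism \<sigma>"
  shows "field_automorphism (inv \<sigma>)" and "\<sigma> (inv \<sigma> x) = x"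
proof -
  have bij: "bij \<sigma>"
    using assms by (simp add: field_automorphism_def)
  show inv: "\<sigma> (inv \<sigma> x) = x" for x
    using bij by (simp add: bij_is_surj surj_f_inv_f)
  have "inv \<sigma> x = y \<longleftrightarrow> x = \<sigma> y" for x y
    by (metis bij bij_inv_eq_iff)
  then show "field_automorphism (inv \<sigma>)"
    using bij by (simp add: field_automorphism_def bij_imp_bij_inv field_automorphism_simps[OF assms] inv)
qed

text \<open>Translation by \<open>1\<close> permutes the field, so adding \<open>1\<close> to every
  element does not change the sum of all elements.\<close>

lemma of_nat_card_eq_0: "of_nat CARD('a) = (0 :: 'a::{finite,field})"
proof -
  have "(\<Sum>x\<in>UNIV. x + 1) = (\<Sum>x\<in>UNIV. x :: 'a)"
    by (rule sum.reindex_bij_betw) (rule bij_plus_right)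
  then show ?thesis
    by (simp add: sum.distrib)
qed

section \<open>The subfield \<open>K\<close> and coordinates over it\<close>

locale quadratic_tower =
  fixes q t :: nat and F :: "'a::{finite,field} itself"
  assumes primepow_q: "primepow q"
    and t_pos: "t > 0"
    and card_F: "CARD('a) = q ^ (2 * t)"
begin

abbreviation K :: "'a set" where "K \<equiv> subfield_of_order (q ^ t)"

abbreviation N :: "'a \<Rightarrow> 'a" where "N \<equiv> field_norm q t"

lemma q_gt_1: "q > 1"
proof -
  obtain p k where "prime p" "k > 0" "q = p ^ k"
    using primepow_q unfolding primepow_def by blast
  then show ?thesis
    using one_less_power[OF prime_gt_1_nat] by blast
qed

lemma K_iff: "x \<in> K \<longleftrightarrow> x ^ (q ^ t) = x"
  by (simp add: subfield_of_order_def)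

lemma frobenius_add: "(x + y :: 'a) ^ (q ^ k) = x ^ (q ^ k) + y ^ (q ^ k)"
proof -
  obtain p m where p: "prime p" and q: "q = p ^ m"
    using primepow_q unfolding primepow_def by blast
  have prime: "prime CHAR('a)"
    by (simp add: prime_CHAR_semidom finite_imp_CHAR_pos)
  \<comment> \<open>The image of \<open>p\<close> is nilpotent in a field, hence zero, which
    identifies the characteristic as \<open>p\<close>.\<close>
  have "(of_nat p :: 'a) ^ (m * (2 * t)) = 0"
    using of_nat_card_eq_0[where ?'a = 'a] by (simp add: card_F q flip: power_mult)
  then have "CHAR('a) dvd p"
    by (simp add: of_nat_eq_0_iff_char_dvd)
  then have "CHAR('a) = p"
    using p prime by (simp add: primes_dvd_imp_eq)
  then show ?thesis
    using freshmans_dream'[OF prime, of "q ^ k" "m * k" x y] by (simp add: q power_mult)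
qed

lemma frobenius_minus: "(- x :: 'a) ^ (q ^ k) = - (x ^ (q ^ k))"
proof -
  \<comment> \<open>Expanding a power of \<open>0\<close> by additivity gives the sign in every
    characteristic, without a split on the parity of \<open>q\<close>.\<close>
  have "(x + - x) ^ (q ^ k) = x ^ (q ^ k) + (- x) ^ (q ^ k)"
    by (rule frobenius_add)
  then show ?thesis
    using q_gt_1 by (simp add: power_0_left eq_neg_iff_add_eq_0 add.commute)
qed

lemma frobenius_sum: "(\<Sum>i\<in>I. f i :: 'a) ^ (q ^ k) = (\<Sum>i\<in>I. f i ^ (q ^ k))"
  using q_gt_1
  by (induction I rule: infinite_finite_induct) (simp_all add: frobenius_add power_0_left)

lemma K_0 [simp]: "0 \<in> K" and K_1 [simp]: "1 \<in> K"
  using q_gt_1 by (simp_all add: K_iff power_0_left)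

lemma K_add: "x \<in> K \<Longrightarrow> y \<in> K \<Longrightarrow> x + y \<in> K"
  by (simp add: K_iff frobenius_add)

lemma K_uminus: "x \<in> K \<Longrightarrow> - x \<in> K"
  by (simp add: K_iff frobenius_minus)

lemma K_diff: "x \<in> K \<Longrightarrow> y \<in> K \<Longrightarrow> x - y \<in> K"
  using K_add[OF _ K_uminus, of x y] by simp

lemma K_mult: "x \<in> K \<Longrightarrow> y \<in> K \<Longrightarrow> x * y \<in> K"
  by (simp add: K_iff power_mult_distrib)

lemma K_divide: "x \<in> K \<Longrightarrow> y \<in> K \<Longrightarrow> x / y \<in> K"
  by (simp add: K_iff power_divide)

lemma K_power: "x \<in> K \<Longrightarrow> x ^ m \<in> K"
  by (metis K_iff power_mult mult.commute)

lemma K_prod: "(\<And>i. i \<in> I \<Longrightarrow> f i \<in> K) \<Longrightarrow> prod f I \<in> K"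
  by (induction I rule: infinite_finite_induct) (auto intro: K_mult)

lemma K_sum: "(\<And>i. i \<in> I \<Longrightarrow> f i \<in> K) \<Longrightarrow> sum f I \<in> K"
  by (induction I rule: infinite_finite_induct) (auto intro: K_add)

lemmas K_closed = K_add K_uminus K_diff K_mult K_divide K_power

text \<open>Applied with \<open>d = - 1\<close>, this bounds the image of the map
  \<open>x ^ (q ^ t) - x\<close> in \<open>card_K_ge\<close>.\<close>

lemma card_roots_frobenius_le:
  fixes d :: 'a
  shows "card {y. y ^ (q ^ t) = d * y} \<le> q ^ t"
proof -
  let ?p = "monom 1 (q ^ t) + monom (- d) 1"
  \<comment> \<open>The two monomials have different degrees, so the leading term survives for every
    \<open>d\<close>.\<close>
  have gt: "q ^ t > 1"
    using one_less_power[OF q_gt_1 t_pos] by simp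
  have deg: "degree ?p = q ^ t"
    using gt by (subst degree_add_eq_left) (auto simp: degree_monom_eq intro: le_less_trans[OF degree_monom_le])
  then have "?p \<noteq> 0"
    using gt by (metis degree_0 not_less_zero)
  then have "card {y. poly ?p y = 0} \<le> q ^ t"
    using card_poly_roots_bound[of ?p] deg by simp
  then show ?thesis
    by (simp add: poly_monom)
qed

text \<open>The fibres of \<open>x \<mapsto> x ^ (q ^ t) - x\<close> are cosets of \<open>K\<close>, and
  its image lies in the set of solutions of \<open>y ^ (q ^ t) = - y\<close>.\<close>

lemma card_K_ge: "card K \<ge> q ^ t"
proof -
  define f where "f x = x ^ (q ^ t) - x" for x :: 'a
  have f_diff: "f (x - y) = f x - f y" for x y
    using frobenius_add[of x "- y" t] by (simp add: f_def frobenius_minus)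
  \<comment> \<open>Since \<open>x ^ (q ^ (2 * t)) = x\<close>, raising to the power
    \<open>q ^ t\<close> swaps the two terms of \<open>f x\<close>.\<close>
  have "f x ^ (q ^ t) = - 1 * f x" for x
    using frobenius_add[of "x ^ (q ^ t)" "- x" t] finite_field_power_card[of x]
    by (simp add: f_def frobenius_minus card_F mult_2 power_add flip: power_mult)
  then have "card (range f) \<le> card {y::'a. y ^ (q ^ t) = - 1 * y}"
    by (intro card_mono) auto
  also have "\<dots> \<le> q ^ t"
    by (rule card_roots_frobenius_le)
  finally have image: "card (range f) \<le> q ^ t" .
  have fibre: "card (f -` {y}) \<le> card K" if "y \<in> range f" for y
  proof -
    from that obtain x0 where x0: "y = f x0"
      by blast
    have "(\<lambda>x. x - x0) ` (f -` {y}) \<subseteq> K"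
    proof (rule image_subsetI)
      fix x assume "x \<in> f -` {y}"
      then have "f (x - x0) = 0"
        by (simp add: f_diff x0 vimage_singleton_eq)
      then show "x - x0 \<in> K"
        by (simp add: K_iff f_def)
    qed
    then show ?thesis
      by (intro card_inj_on_le[of "\<lambda>x. x - x0"]) (auto simp: inj_on_def)
  qed
  have "CARD('a) = card (\<Union>y\<in>range f. f -` {y})"
    by (rule arg_cong[of _ _ card]) auto
  also have "\<dots> \<le> (\<Sum>y\<in>range f. card (f -` {y}))"
    by (rule card_UN_le) simp
  also have "\<dots> \<le> card (range f) * card K"
    using sum_bounded_above[of "range f" "\<lambda>y. card (f -` {y})" "card K"] fibre by simp
  also have "\<dots> \<le> q ^ t * card K"
    by (rule mult_right_mono[OF image]) simp
  finally have "q ^ t * q ^ t \<le> q ^ t * card K"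
    by (simp add: card_F mult_2 power_add)
  then show ?thesis
    using q_gt_1 by (simp add: mult_le_cancel1)
qed

text \<open>Otherwise \<zeta> would be a quotient of two elements of \<open>K\<close>.\<close>

lemma K_coordinates_unique:
  assumes "\<zeta> \<notin> K" "x \<in> K" "y \<in> K" "x' \<in> K" "y' \<in> K"
    and eq: "x + \<zeta> * y = x' + \<zeta> * y'"
  shows "x = x' \<and> y = y'"
proof -
  have *: "\<zeta> * (y - y') = x' - x"
    using eq by (simp add: algebra_simps)
  have "y = y'"
  proof (rule ccontr)
    assume "y \<noteq> y'"
    then have "\<zeta> = (x' - x) / (y - y')"
      using * by (simp add: field_simps)
    then show False
      using assms K_closed by metis
  qed
  then show ?thesis
    using eq by simp
qed

text \<open>Pairs of coordinates inject into the field and, by \<open>card_K_ge\<close>, number at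
  least \<open>q ^ (2 * t)\<close>, so they exhaust it.\<close>

lemma K_coordinates_exist:
  assumes "\<zeta> \<notin> K"
  obtains x y where "x \<in> K" "y \<in> K" "\<alpha> = x + \<zeta> * y"
proof -
  let ?f = "\<lambda>(x, y). x + \<zeta> * y"
  have "inj_on ?f (K \<times> K)"
    using K_coordinates_unique[OF assms] by (auto simp: inj_on_def)
  then have "card (?f ` (K \<times> K)) = card K * card K"
    by (simp add: card_image card_cartesian_product)
  also have "\<dots> \<ge> CARD('a)"
    using mult_mono[OF card_K_ge card_K_ge] by (simp add: card_F mult_2 power_add)
  finally have "?f ` (K \<times> K) = UNIV"
    by (intro card_seteq) auto
  then have "\<alpha> \<in> ?f ` (K \<times> K)"
    by simp
  then show ?thesis
    using that by auto
qed

section \<open>Linearized polynomials on \<open>K\<close>\<close>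

lemma frobenius_mod:
  assumes "u \<in> K"
  shows "u ^ (q ^ (k mod t)) = u ^ (q ^ k)"
proof -
  have "u ^ (q ^ (t * m)) = u" for m
    using assms by (induction m) (simp_all add: power_add power_mult K_iff)
  then have "u ^ (q ^ (t * (k div t) + k mod t)) = u ^ (q ^ (k mod t))"
    by (simp only: power_add power_mult)
  then show ?thesis by simp
qed

text \<open>The polynomial has degree at most \<open>q ^ (t - 1)\<close> but at least
  \<open>q ^ t\<close> roots, so it is zero.\<close>

lemma linearized_polynomial_zero_imp:
  fixes c :: "nat \<Rightarrow> 'a"
  assumes zero: "\<And>u. u \<in> K \<Longrightarrow> (\<Sum>i<t. c i * u ^ (q ^ i)) = 0" and "i < t"
  shows "c i = 0"
proof -
  define p where "p = (\<Sum>i<t. monom (c i) (q ^ i))"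
  have "degree p \<le> q ^ (t - 1)"
    unfolding p_def
  proof (rule degree_sum_le)
    fix j assume "j \<in> {..<t}"
    then have "q ^ j \<le> q ^ (t - 1)"
      using q_gt_1 by (intro power_increasing) auto
    then show "degree (monom (c j) (q ^ j)) \<le> q ^ (t - 1)"
      using degree_monom_le order_trans by blast
  qed simp
  also have "\<dots> < q ^ t"
    using q_gt_1 t_pos by (intro power_strict_increasing) auto
  also have "\<dots> \<le> card {x. poly p x = 0}"
    using zero by (intro order_trans[OF card_K_ge] card_mono) (auto simp: p_def poly_sum poly_monom)
  finally have "p = 0"
    using card_poly_roots_bound[of p] by fastforce
  have "0 = coeff p (q ^ i)"
    using \<open>p = 0\<close> by simp
  \<comment> \<open>The exponents \<open>q ^ j\<close> are distinct because \<open>q > 1\<close>, so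
    no two terms share a coefficient.\<close>
  also have "\<dots> = (\<Sum>j<t. if j = i then c j else 0)"
    unfolding p_def coeff_sum using q_gt_1 by (intro sum.cong) (auto simp: power_inject_exp)
  finally show ?thesis
    using \<open>i < t\<close> by simp
qed

text \<open>On \<open>K\<close> only the residues of the \<open>k j\<close> modulo \<open>t\<close>
  matter. Terms may share a residue, so what is forced to vanish is the sum over each residue
  class.\<close>

lemma linearized_polynomial_coefficient:
  fixes d :: "'b \<Rightarrow> 'a"
  assumes zero: "\<And>u. u \<in> K \<Longrightarrow> (\<Sum>j\<in>J. d j * u ^ (q ^ k j)) = 0" and "i < t"
  shows "(\<Sum>j\<in>J. if k j mod t = i then d j else 0) = 0"
proof (rule linearized_polynomial_zero_imp[OF _ \<open>i < t\<close>])
  fix u assume u: "u \<in> K"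
  have "(\<Sum>i<t. (\<Sum>j\<in>J. if k j mod t = i then d j else 0) * u ^ (q ^ i))
      = (\<Sum>i<t. \<Sum>j\<in>J. if k j mod t = i then d j * u ^ (q ^ i) else 0)"
    by (simp add: sum_distrib_right if_distrib[of "\<lambda>x. x * _"] cong: if_cong)
  also have "\<dots> = (\<Sum>j\<in>J. \<Sum>i<t. if k j mod t = i then d j * u ^ (q ^ i) else 0)"
    by (rule sum.swap)
  also have "\<dots> = (\<Sum>j\<in>J. d j * u ^ (q ^ k j))"
    using t_pos by (simp add: frobenius_mod[OF u])
  finally show "(\<Sum>i<t. (\<Sum>j\<in>J. if k j mod t = i then d j else 0) * u ^ (q ^ i)) = 0"
    by (simp add: zero[OF u])
qed

lemma norm_mult: "N (x * y) = N x * N y"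
  by (simp add: field_norm_def power_mult_distrib prod.distrib)

lemma norm_1 [simp]: "N 1 = 1"
  by (simp add: field_norm_def)

lemma norm_divide: "N (x / y) = N x / N y"
  by (simp add: field_norm_def power_divide prod_dividef)

lemma norm_eq_0_iff [simp]: "N x = 0 \<longleftrightarrow> x = 0"
  using q_gt_1 t_pos by (auto simp: field_norm_def prod_zero_iff power_0_left)

lemma norm_frobenius:
  assumes "x \<in> K"
  shows "N (x ^ (q ^ k)) = N x"
proof (induction k)
  case (Suc k)
  define y where "y = x ^ (q ^ k)"
  have "y \<in> K"
    using assms by (simp add: y_def K_power)
  \<comment> \<open>The product of \<open>t + 1\<close> successive conjugates, split at either end;
    its last factor \<open>y ^ (q ^ t)\<close> equals \<open>y\<close>.\<close>
  have "N (y ^ q) * y = (\<Prod>i<Suc t. y ^ (q ^ i))"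
    by (simp only: prod.lessThan_Suc_shift field_norm_def) (simp add: mult.commute flip: power_mult)
  also have "\<dots> = N y * y"
    using \<open>y \<in> K\<close> by (simp add: field_norm_def K_iff)
  finally have "N (y ^ q) = N y"
    using q_gt_1 t_pos by (cases "y = 0") (simp_all add: power_0_left)
  then show ?case
    using Suc.IH by (simp add: y_def mult.commute flip: power_mult)
qed simp

lemma bij_betw_mult_mod:
  assumes "coprime s t"
  shows "bij_betw (\<lambda>i. (s * i) mod t) {..<t} {..<t}"
proof -
  have "inj_on (\<lambda>i. (s * i) mod t) {..<t}"
  proof (rule inj_onI)
    fix i j assume "i \<in> {..<t}" "j \<in> {..<t}" "(s * i) mod t = (s * j) mod t"
    then show "i = j"
      using cong_mult_lcancel_nat[OF assms, of i j] by (simp add: cong_def)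
  qed
  then show ?thesis
    using t_pos by (simp add: bij_betw_def endo_inj_surj image_subset_iff)
qed

text \<open>As \<open>s\<close> is a unit modulo \<open>t\<close>, iterating the power map
  \<open>q ^ s\<close> runs through the same conjugates in another order.\<close>

lemma norm_eq_prod_power:
  assumes "coprime s t" "z \<in> K"
  shows "N z = (\<Prod>i<t. z ^ (q ^ (s * i)))"
  using prod.reindex_bij_betw[OF bij_betw_mult_mod[OF assms(1)], of "\<lambda>i. z ^ (q ^ i)"]
  by (simp add: field_norm_def frobenius_mod[OF assms(2)])

text \<open>Hilbert's Theorem 90; \<open>x\<close> is a Lagrange resolvent.\<close>

lemma hilbert_90:
  assumes s: "coprime s t" and z: "z \<in> K" "N z = 1"
  obtains x where "x \<in> K" "x \<noteq> 0" "x = z * x ^ (q ^ s)"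
proof -
  \<comment> \<open>Partial products of the norm: twisting by \<open>z\<close> moves
    \<open>w i\<close> to \<open>w (Suc i)\<close>, and \<open>N z = 1\<close> closes the cycle with
    \<open>w t = w 0\<close>.\<close>
  define w where "w i = (\<Prod>j<i. z ^ (q ^ (s * j)))" for i
  have w_Suc: "z * w i ^ (q ^ s) = w (Suc i)" for i
    unfolding w_def prod.lessThan_Suc_shift
    by (simp only: prod_power_distrib power_mult[symmetric] power_add[symmetric] mult_Suc_right
        add.commute) simp
  have w_t: "w t = 1"
    using norm_eq_prod_power[OF s z(1)] z(2) by (simp add: w_def)
  \<comment> \<open>If the resolvent vanished on all of \<open>K\<close>, so would its coefficient
    at residue \<open>0\<close>, which is \<open>w 0 = 1\<close>.\<close>
  obtain u where u: "u \<in> K" "(\<Sum>i<t. w i * u ^ (q ^ (s * i))) \<noteq> 0"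
  proof (rule ccontr)
    assume "\<not> thesis"
    then have "(\<Sum>i<t. w i * u ^ (q ^ (s * i))) = 0" if "u \<in> K" for u
      using that \<open>\<And>u. u \<in> K \<Longrightarrow> _ \<noteq> 0 \<Longrightarrow> thesis\<close> by blast
    then have "(\<Sum>i<t. if (s * i) mod t = 0 then w i else 0) = 0"
      by (rule linearized_polynomial_coefficient) (use t_pos in auto)
    also have "(\<Sum>i<t. if (s * i) mod t = 0 then w i else 0) = (\<Sum>i<t. if i = 0 then w i else 0)"
    proof (rule sum.cong)
      fix i assume "i \<in> {..<t}"
      then have "(s * i) mod t = 0 \<longleftrightarrow> i = 0"
        using s by (auto simp: mod_eq_0_iff_dvd coprime_commute coprime_dvd_mult_right_iff dest: dvd_imp_le)
      then show "(if (s * i) mod t = 0 then w i else 0) = (if i = 0 then w i else 0)"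
        by simp
    qed simp
    finally show False
      using t_pos by (simp add: w_def)
  qed
  define x where "x = (\<Sum>i<t. w i * u ^ (q ^ (s * i)))"
  have "x \<in> K"
    unfolding x_def w_def using u(1) z(1) by (intro K_sum K_mult K_prod K_power)
  moreover have "x \<noteq> 0"
    using u by (simp add: x_def)
  moreover have "x = z * x ^ (q ^ s)"
  proof -
    have u_Suc: "(u ^ (q ^ (s * i))) ^ (q ^ s) = u ^ (q ^ (s * Suc i))" for i
      by (simp only: power_mult[symmetric] power_add[symmetric] mult_Suc_right add.commute)
    \<comment> \<open>The twist shifts the sum by one index. The term dropped at \<open>0\<close>
      and the term gained at \<open>t\<close> are both \<open>u\<close>.\<close>
    have "z * x ^ (q ^ s) = (\<Sum>i<t. (z * w i ^ (q ^ s)) * u ^ (q ^ (s * Suc i)))"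
      by (simp only: x_def frobenius_sum sum_distrib_left power_mult_distrib u_Suc mult.assoc)
    then have "z * x ^ (q ^ s) = (\<Sum>i<t. w (Suc i) * u ^ (q ^ (s * Suc i)))"
      by (simp only: w_Suc)
    moreover have "w 0 * u ^ (q ^ (s * 0)) + \<dots> = (\<Sum>i<Suc t. w i * u ^ (q ^ (s * i)))"
      by (simp only: sum.lessThan_Suc_shift)
    moreover have "\<dots> = x + u"
      using u(1) frobenius_mod[OF u(1), of "s * t"] by (simp add: x_def w_t)
    ultimately show ?thesis
      by (simp add: w_def)
  qed
  ultimately show ?thesis
    by (rule that)
qed

lemma norm_automorphism:
  assumes "field_automorphism \<sigma>"
  shows "N (\<sigma> x) = \<sigma> (N x)"
proof -
  have "\<sigma> (\<Prod>i<m. x ^ (q ^ i)) = (\<Prod>i<m. \<sigma> x ^ (q ^ i))" for m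
    by (induction m) (simp_all add: field_automorphism_simps[OF assms])
  then show ?thesis
    by (simp add: field_norm_def)
qed

lemma automorphism_in_K:
  assumes "field_automorphism \<sigma>" "x \<in> K"
  shows "\<sigma> x \<in> K"
  using assms(2) field_automorphism_simps(5)[OF assms(1), of x "q ^ t"] by (simp add: K_iff)

text \<open>This and the next variant turn the existential conditions of the theorem into norm
  equations; the witness \<open>c\<close> is a quotient.\<close>

lemma norm_eq_iff:
  assumes "x \<in> K" "y \<in> K" "x \<noteq> 0" "y \<noteq> 0"
  shows "N x = N y \<longleftrightarrow> (\<exists>c\<in>K. N c = 1 \<and> x = c * y)"
proof
  assume "N x = N y"
  then show "\<exists>c\<in>K. N c = 1 \<and> x = c * y"
    using assms by (intro bexI[of _ "x / y"]) (auto simp: norm_divide intro: K_divide)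
qed (auto simp: norm_mult)

lemma norm_eq_iff_divide:
  assumes "x \<in> K" "y \<in> K" "x \<noteq> 0" "y \<noteq> 0"
  shows "N x = N y \<longleftrightarrow> (\<exists>c\<in>K. N c = 1 \<and> x = y / c)"
proof
  assume "N x = N y"
  then show "\<exists>c\<in>K. N c = 1 \<and> x = y / c"
    using assms by (intro bexI[of _ "y / x"]) (auto simp: norm_divide intro: K_divide)
qed (auto simp: norm_divide)

text \<open>Makes sense of the power with exponent q^(-s). The map is injective on a finite set,
  hence bijective; the root lies in \<open>K\<close> since its power with exponent
  \<open>q ^ t\<close> is a root of the same element.\<close>

lemma frobenius_root_in_K:
  assumes "x \<in> K"
  shows "inv (\<lambda>x. x ^ (q ^ k)) x \<in> K" and "inv (\<lambda>x. x ^ (q ^ k)) x ^ (q ^ k) = x"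
proof -
  have inj: "inj (\<lambda>x::'a. x ^ (q ^ k))"
  proof (rule injI)
    fix x y :: 'a assume "x ^ (q ^ k) = y ^ (q ^ k)"
    then have "(x - y) ^ (q ^ k) = 0"
      using frobenius_add[of x "- y" k] by (simp add: frobenius_minus)
    then show "x = y"
      by simp
  qed
  then have "surj (\<lambda>x::'a. x ^ (q ^ k))"
    by (simp add: finite_UNIV_inj_surj)
  then show root: "inv (\<lambda>x. x ^ (q ^ k)) x ^ (q ^ k) = x"
    by (rule surj_f_inv_f)
  let ?y = "inv (\<lambda>x. x ^ (q ^ k)) x"
  have "(?y ^ (q ^ t)) ^ (q ^ k) = (?y ^ (q ^ k)) ^ (q ^ t)"
    by (simp only: power_mult[symmetric] mult.commute)
  also have "\<dots> = ?y ^ (q ^ k)"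
    using assms by (simp add: root K_iff)
  finally show "?y \<in> K"
    using injD[OF inj] unfolding K_iff by blast
qed

section \<open>Scalar equivalences between the sets \<open>L\<close>\<close>

abbreviation L :: "'a \<Rightarrow> nat \<Rightarrow> 'a \<Rightarrow> 'a set" where
  "L \<nu> s \<zeta> \<equiv> poly_subspace K (\<lambda>x. \<nu> * x ^ (q ^ s)) \<zeta>"

lemma L_eq_image: "L \<nu> s \<zeta> = (\<lambda>u. u + \<zeta> * (\<nu> * u ^ (q ^ s))) ` K"
  by (auto simp: poly_subspace_def)

lemma card_L:
  assumes "\<zeta> \<notin> K" "\<nu> \<in> K"
  shows "card (L \<nu> s \<zeta>) = card K"
proof -
  have "inj_on (\<lambda>u. u + \<zeta> * (\<nu> * u ^ (q ^ s))) K"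
    using K_coordinates_unique[OF assms(1)] assms(2) by (meson inj_onI K_mult K_power)
  then show ?thesis
    by (simp add: L_eq_image card_image)
qed

lemma zero_in_L: "0 \<in> L \<nu> s \<zeta>"
  using q_gt_1 by (auto simp: poly_subspace_def power_0_left intro!: exI[of _ 0])

text \<open>As \<sigma> permutes \<open>K\<close>, it only changes the two parameters; a semilinear
  equivalence thus reduces to multiplication by a scalar.\<close>

lemma automorphism_image_L:
  assumes \<sigma>: "field_automorphism \<sigma>"
  shows "\<sigma> ` L \<nu> s \<zeta> = L (\<sigma> \<nu>) s (\<sigma> \<zeta>)"
proof -
  have "\<sigma> ` K = K"
    using automorphism_in_K[OF \<sigma>] \<sigma>
    by (intro endo_inj_surj) (auto simp: field_automorphism_def intro: inj_on_subset bij_is_inj)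
  have "\<sigma> ` L \<nu> s \<zeta> = (\<lambda>u. u + \<sigma> \<zeta> * (\<sigma> \<nu> * u ^ (q ^ s))) ` \<sigma> ` K"
    by (simp add: L_eq_image image_image field_automorphism_simps[OF \<sigma>])
  then show ?thesis
    by (simp only: \<open>\<sigma> ` K = K\<close> L_eq_image)
qed

lemma coordinates_scale_subset_iff:
  assumes \<xi>: "\<xi> \<notin> K" "\<xi>\<^sup>2 = a * \<xi> + b" and ab: "a \<in> K" "b \<in> K"
    and AB: "A \<in> K" "B \<in> K" and \<nu>: "\<nu> \<in> K" "\<nu>' \<in> K" and xy: "x \<in> K" "y \<in> K"
  shows "(*) (x + \<xi> * y) ` L \<nu>' s' (A * \<xi> + B) \<subseteq> L \<nu> s \<xi> \<longleftrightarrow>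
    (\<forall>u\<in>K. y * u + (y * B + x * A + y * A * a) * \<nu>' * u ^ (q ^ s') =
      \<nu> * (x * u + (x * B + y * A * b) * \<nu>' * u ^ (q ^ s')) ^ (q ^ s))"
proof -
  \<comment> \<open>\<open>f u\<close> and \<open>g u\<close> are the coordinates over
    \<open>1\<close> and \<xi> of the scaled element, after \<xi> squared is replaced by
    \<open>a * \<xi> + b\<close>.\<close>
  define f where "f u = x * u + (x * B + y * A * b) * \<nu>' * u ^ (q ^ s')" for u
  define g where "g u = y * u + (y * B + x * A + y * A * a) * \<nu>' * u ^ (q ^ s')" for u
  have fg: "f u \<in> K" "g u \<in> K" if "u \<in> K" for u
    using that ab AB \<nu> xy by (auto simp: f_def g_def intro!: K_add K_mult intro: K_power)
  have "(x + \<xi> * y) * (u + (A * \<xi> + B) * (\<nu>' * u ^ (q ^ s')))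
      = x * u + x * B * \<nu>' * u ^ (q ^ s') + \<xi> * (y * u + (y * B + x * A) * \<nu>' * u ^ (q ^ s'))
        + \<xi>\<^sup>2 * (y * A * \<nu>' * u ^ (q ^ s'))" for u
    by (simp add: algebra_simps power2_eq_square)
  then have expand: "(x + \<xi> * y) * (u + (A * \<xi> + B) * (\<nu>' * u ^ (q ^ s'))) = f u + \<xi> * g u" for u
    by (simp add: \<xi>(2) f_def g_def algebra_simps)
  have mem: "f u + \<xi> * g u \<in> L \<nu> s \<xi> \<longleftrightarrow> g u = \<nu> * f u ^ (q ^ s)" if u: "u \<in> K" for u
  proof
    assume "f u + \<xi> * g u \<in> L \<nu> s \<xi>"
    then obtain v where "v \<in> K" "f u + \<xi> * g u = v + \<xi> * (\<nu> * v ^ (q ^ s))"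
      by (auto simp: poly_subspace_def)
    then show "g u = \<nu> * f u ^ (q ^ s)"
      using K_coordinates_unique[OF \<xi>(1) fg[OF u]] \<nu>(1) K_mult K_power by metis
  next
    assume "g u = \<nu> * f u ^ (q ^ s)"
    then show "f u + \<xi> * g u \<in> L \<nu> s \<xi>"
      using fg[OF u] by (auto simp: poly_subspace_def)
  qed
  have "(*) (x + \<xi> * y) ` L \<nu>' s' (A * \<xi> + B) = (\<lambda>u. f u + \<xi> * g u) ` K"
    by (auto simp: poly_subspace_def image_iff simp flip: expand)
  then show ?thesis
    using mem by (auto simp: f_def g_def image_subset_iff)
qed

text \<open>Otherwise \<open>t\<close> divides \<open>2 * s\<close>, hence \<open>2\<close>. This
  keeps the cases (I) and (II) apart.\<close>

lemma add_mod_ne_0: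
  assumes "t \<ge> 3" "coprime s t" and eq: "s mod t = s' mod t"
  shows "(s + s') mod t \<noteq> 0"
proof
  assume "(s + s') mod t = 0"
  then have "t dvd s * 2"
    using eq by (metis mod_add_right_eq mod_eq_0_iff_dvd mult_2_right)
  then have "t dvd 2"
    using \<open>coprime s t\<close> by (simp add: coprime_commute coprime_dvd_mult_right_iff)
  then show False
    using \<open>t \<ge> 3\<close> by (auto dest: dvd_imp_le)
qed

text \<open>Comparing the coefficients of the exponents \<open>0\<close>, \<open>s\<close>, \<open>s'\<close> and \<open>s + s'\<close> modulo \<open>t\<close>:
  a coincidence among them, which leaves room for a nonzero solution, occurs only
  if \<open>s\<close> is congruent to \<open>s'\<close> or to \<open>- s'\<close>.\<close>

lemma frobenius_identity_iff:
  assumes "t \<ge> 3" and s: "coprime s t" "coprime s' t"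
    and nz: "A \<noteq> 0" "\<nu> \<noteq> 0" "\<nu>' \<noteq> 0" "x \<noteq> 0 \<or> y \<noteq> 0"
  shows "(\<forall>u\<in>K. y * u + (y * B + x * A + y * A * a) * \<nu>' * u ^ (q ^ s') =
      \<nu> * (x * u + (x * B + y * A * b) * \<nu>' * u ^ (q ^ s')) ^ (q ^ s)) \<longleftrightarrow>
    (s mod t = s' mod t \<and> y = 0 \<and> B = 0 \<and> x * A * \<nu>' = \<nu> * x ^ (q ^ s)) \<or>
    ((s + s') mod t = 0 \<and> x = 0 \<and> B = - (A * a) \<and> y = \<nu> * (y * A * b * \<nu>') ^ (q ^ s))"
    (is "?lhs \<longleftrightarrow> ?rhs")
proof -
  have expand: "(x * u + (x * B + y * A * b) * \<nu>' * u ^ (q ^ s')) ^ (q ^ s) =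
      x ^ (q ^ s) * u ^ (q ^ s) + ((x * B + y * A * b) * \<nu>') ^ (q ^ s) * u ^ (q ^ (s + s'))" for u
    by (simp only: frobenius_add power_mult_distrib power_mult[symmetric] power_add[symmetric] add.commute)
  show ?thesis
  proof
    assume ?lhs
    \<comment> \<open>The identity with all terms on one side: four coefficients \<open>d j\<close>
      with exponents \<open>k j\<close>.\<close>
    define d where "d j = [y, (y * B + x * A + y * A * a) * \<nu>',
      - (\<nu> * x ^ (q ^ s)), - (\<nu> * ((x * B + y * A * b) * \<nu>') ^ (q ^ s))] ! j" for j :: nat
    define k where "k j = [0, s', s, s + s'] ! j" for j :: nat
    have zero: "(\<Sum>j\<in>{0, 1, 2, 3}. d j * u ^ (q ^ k j)) = 0" if "u \<in> K" for u
      using \<open>?lhs\<close>[rule_format, OF that] unfolding expand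
      by (simp add: d_def k_def algebra_simps)
    have coeff: "(\<Sum>j\<in>{0, 1, 2, 3}. if k j mod t = i then d j else 0) = 0" if "i < t" for i
      by (rule linearized_polynomial_coefficient[where d = d and k = k and J = "{0, 1, 2, 3}"])
        (use zero that in simp_all)
    have s_nz: "s mod t \<noteq> 0" "s' mod t \<noteq> 0"
      using s \<open>t \<ge> 3\<close> coprime_common_divisor[of s t t] coprime_common_divisor[of s' t t]
      by (auto simp: mod_eq_0_iff_dvd)
    \<comment> \<open>The only possible coincidences left are \<open>s\<close> with
      \<open>s'\<close>, and \<open>s + s'\<close> with \<open>0\<close>.\<close>
    have sum_ne: "(s + s') mod t \<noteq> s mod t" "(s + s') mod t \<noteq> s' mod t"
      using s_nz by (metis add.right_neutral cong_add_lcancel_nat cong_def mod_0,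
        metis add.right_neutral add.commute cong_add_lcancel_nat cong_def mod_0)
    have c0: "(if (s + s') mod t = 0 then \<nu> * ((x * B + y * A * b) * \<nu>') ^ (q ^ s) else 0) = y"
      using coeff[of 0] \<open>t \<ge> 3\<close> s_nz by (simp add: d_def k_def split: if_splits)
    have c_s: "\<nu> * x ^ (q ^ s) =
        (if s' mod t = s mod t then (y * B + x * A + y * A * a) * \<nu>' else 0)"
      using coeff[of "s mod t"] \<open>t \<ge> 3\<close> s_nz sum_ne by (simp add: d_def k_def split: if_splits)
    have c_s': "(y * B + x * A + y * A * a) * \<nu>' =
        (if s mod t = s' mod t then \<nu> * x ^ (q ^ s) else 0)"
      using coeff[of "s' mod t"] \<open>t \<ge> 3\<close> s_nz sum_ne by (simp add: d_def k_def split: if_splits)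
    have c_sum: "\<nu> * ((x * B + y * A * b) * \<nu>') ^ (q ^ s) = (if (s + s') mod t = 0 then y else 0)"
      using coeff[of "(s + s') mod t"] \<open>t \<ge> 3\<close> sum_ne by (simp add: d_def k_def split: if_splits)
    \<comment> \<open>The first case forces \<open>y = 0\<close>, the second \<open>x = 0\<close>,
      and the third both, against \<open>nz\<close>.\<close>
    consider "s mod t = s' mod t" "(s + s') mod t \<noteq> 0" | "s mod t \<noteq> s' mod t" "(s + s') mod t = 0"
      | "s mod t \<noteq> s' mod t" "(s + s') mod t \<noteq> 0"
      using add_mod_ne_0[OF \<open>t \<ge> 3\<close> s(1)] by blast
    then show ?rhs
    proof cases
      case 1
      then have "y = 0"
        using c0 by (simp only: if_False)
      then have "B = 0"
        using 1 c_sum nz by simp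
      then show ?thesis
        using 1 c_s \<open>y = 0\<close> by simp
    next
      case 2
      then have "x = 0"
        using c_s nz by auto
      have "y * B + x * A + y * A * a = 0"
        using 2 c_s' nz(3) by simp
      then have "y * (B + A * a) = 0"
        using \<open>x = 0\<close> by (simp add: distrib_left mult.assoc)
      then have "B = - (A * a)"
        using \<open>x = 0\<close> nz by (simp add: eq_neg_iff_add_eq_0)
      then show ?thesis
        using 2 c_sum \<open>x = 0\<close> by simp
    next
      case 3
      then show ?thesis
        using c0 c_s nz by (simp only: if_False) simp
    qed
  next
    assume ?rhs
    then show ?lhs
    proof (elim disjE conjE)
      assume *: "s mod t = s' mod t" "y = 0" "B = 0" "x * A * \<nu>' = \<nu> * x ^ (q ^ s)"
      show ?lhs
      proof
        fix u assume "u \<in> K"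
        then have "u ^ (q ^ s') = u ^ (q ^ s)"
          using *(1) frobenius_mod by metis
        then show "y * u + (y * B + x * A + y * A * a) * \<nu>' * u ^ (q ^ s') =
            \<nu> * (x * u + (x * B + y * A * b) * \<nu>' * u ^ (q ^ s')) ^ (q ^ s)"
          using * by (simp add: power_mult_distrib flip: mult.assoc)
      qed
    next
      assume *: "(s + s') mod t = 0" "x = 0" "B = - (A * a)" "y = \<nu> * (y * A * b * \<nu>') ^ (q ^ s)"
      show ?lhs
      proof
        fix u assume "u \<in> K"
        then have u: "u ^ (q ^ (s + s')) = u"
          using *(1) frobenius_mod[of u "s + s'"] by simp
        have scaled: "(y * A * b * \<nu>' * u ^ (q ^ s')) ^ (q ^ s) = (y * A * b * \<nu>') ^ (q ^ s) * u"
          by (simp only: power_mult_distrib power_mult[symmetric] power_add[symmetric]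
              add.commute[of s'] u)
        have "y * u = \<nu> * (y * A * b * \<nu>') ^ (q ^ s) * u"
          by (rule arg_cong[OF *(4)])
        also have "\<dots> = \<nu> * (y * A * b * \<nu>' * u ^ (q ^ s')) ^ (q ^ s)"
          by (subst scaled) (rule mult.assoc)
        finally show "y * u + (y * B + x * A + y * A * a) * \<nu>' * u ^ (q ^ s') =
            \<nu> * (x * u + (x * B + y * A * b) * \<nu>' * u ^ (q ^ s')) ^ (q ^ s)"
          by (simp add: *(2,3) mult.assoc)
      qed
    qed
  qed
qed

lemma scale_subset_iff:
  assumes "t \<ge> 3" and s: "coprime s t" "coprime s' t"
    and \<xi>: "\<xi> \<notin> K" "\<xi>\<^sup>2 = a * \<xi> + b" and ab: "a \<in> K" "b \<in> K"
    and AB: "A \<in> K" "B \<in> K" "A \<noteq> 0" and \<nu>: "\<nu> \<in> K" "\<nu>' \<in> K" "\<nu> \<noteq> 0" "\<nu>' \<noteq> 0"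
  shows "(\<exists>\<alpha>. \<alpha> \<noteq> 0 \<and> (*) \<alpha> ` L \<nu>' s' (A * \<xi> + B) \<subseteq> L \<nu> s \<xi>) \<longleftrightarrow>
    (s mod t = s' mod t \<and> B = 0 \<and> N (A * \<nu>') = N \<nu>) \<or>
    ((s + s') mod t = 0 \<and> B = - (A * a) \<and> N \<nu> * N (A * b * \<nu>') = 1)"
    (is "?lhs \<longleftrightarrow> ?rhs")
proof
  assume ?lhs
  then obtain \<alpha> where \<alpha>: "\<alpha> \<noteq> 0" "(*) \<alpha> ` L \<nu>' s' (A * \<xi> + B) \<subseteq> L \<nu> s \<xi>"
    by blast
  obtain x y where xy: "x \<in> K" "y \<in> K" "\<alpha> = x + \<xi> * y"
    using K_coordinates_exist[OF \<xi>(1)] .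
  have nz: "x \<noteq> 0 \<or> y \<noteq> 0"
    using \<alpha>(1) xy(3) by auto
  have "(s mod t = s' mod t \<and> y = 0 \<and> B = 0 \<and> x * A * \<nu>' = \<nu> * x ^ (q ^ s)) \<or>
    ((s + s') mod t = 0 \<and> x = 0 \<and> B = - (A * a) \<and> y = \<nu> * (y * A * b * \<nu>') ^ (q ^ s))"
    using \<alpha>(2) unfolding xy(3)
      coordinates_scale_subset_iff[OF \<xi> ab AB(1,2) \<nu>(1,2) xy(1,2)]
      frobenius_identity_iff[OF assms(1) s AB(3) \<nu>(3,4) nz] .
  then show ?rhs
  proof (elim disjE conjE)
    assume *: "s mod t = s' mod t" "y = 0" "B = 0" "x * A * \<nu>' = \<nu> * x ^ (q ^ s)"
    have "N (x * A * \<nu>') = N (\<nu> * x ^ (q ^ s))"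
      using *(4) by simp
    then have "N x * N (A * \<nu>') = N x * N \<nu>"
      by (simp add: norm_mult norm_frobenius[OF xy(1)] mult_ac)
    then have "N (A * \<nu>') = N \<nu>"
      using nz *(2) by simp
    then show ?thesis
      using * by simp
  next
    assume *: "(s + s') mod t = 0" "x = 0" "B = - (A * a)" "y = \<nu> * (y * A * b * \<nu>') ^ (q ^ s)"
    have "y * A * b * \<nu>' \<in> K"
      using xy AB ab \<nu> by (intro K_closed)
    then have "N y = N (\<nu> * (y * A * b * \<nu>'))"
      using *(4) by (metis norm_mult norm_frobenius)
    then have "N y * (N \<nu> * N (A * b * \<nu>')) = N y * 1"
      by (simp add: norm_mult mult_ac)
    then have "N \<nu> * N (A * b * \<nu>') = 1"
      using nz *(2) by simp
    then show ?thesis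
      using *(1,3) by simp
  qed
next
  assume ?rhs
  then obtain x y where xy: "x \<in> K" "y \<in> K" and nz: "x \<noteq> 0 \<or> y \<noteq> 0"
    and *: "(s mod t = s' mod t \<and> y = 0 \<and> B = 0 \<and> x * A * \<nu>' = \<nu> * x ^ (q ^ s)) \<or>
    ((s + s') mod t = 0 \<and> x = 0 \<and> B = - (A * a) \<and> y = \<nu> * (y * A * b * \<nu>') ^ (q ^ s))"
  proof (elim disjE conjE)
    assume *: "s mod t = s' mod t" "B = 0" "N (A * \<nu>') = N \<nu>"
    have "\<nu> / (A * \<nu>') \<in> K" "N (\<nu> / (A * \<nu>')) = 1"
      using AB \<nu> * by (auto intro: K_closed simp: norm_divide norm_mult)
    then obtain x where x: "x \<in> K" "x \<noteq> 0" "x = \<nu> / (A * \<nu>') * x ^ (q ^ s)"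
      by (rule hilbert_90[OF s(1)])
    have "x * A * \<nu>' = \<nu> * x ^ (q ^ s)"
      using x(3) AB(3) \<nu>(4) by (simp add: field_simps)
    then show thesis
      using that[of x 0] * x by simp
  next
    assume *: "(s + s') mod t = 0" "B = - (A * a)" "N \<nu> * N (A * b * \<nu>') = 1"
    have "A * b * \<nu>' \<in> K"
      using AB ab \<nu> by (intro K_closed)
    then have "\<nu> * (A * b * \<nu>') ^ (q ^ s) \<in> K" "N (\<nu> * (A * b * \<nu>') ^ (q ^ s)) = 1"
      using \<nu>(1) *(3) by (auto intro: K_closed simp: norm_frobenius norm_mult[of \<nu>])
    then obtain y where y: "y \<in> K" "y \<noteq> 0" "y = \<nu> * (A * b * \<nu>') ^ (q ^ s) * y ^ (q ^ s)"
      by (rule hilbert_90[OF s(1)])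
    have "y = \<nu> * (y * A * b * \<nu>') ^ (q ^ s)"
      using y(3) by (simp add: power_mult_distrib mult_ac)
    with *(1,2) y(1,2) show thesis
      by (intro that[of 0 y] disjI2 conjI K_0 refl)
  qed
  have "(*) (x + \<xi> * y) ` L \<nu>' s' (A * \<xi> + B) \<subseteq> L \<nu> s \<xi>"
    unfolding coordinates_scale_subset_iff[OF \<xi> ab AB(1,2) \<nu>(1,2) xy]
      frobenius_identity_iff[OF assms(1) s AB(3) \<nu>(3,4) nz]
    by (rule *)
  moreover have "x + \<xi> * y \<noteq> 0"
    using K_coordinates_unique[OF \<xi>(1) xy K_0 K_0] nz by auto
  ultimately show ?lhs
    by blast
qed

end

section \<open>Semilinear maps between products\<close>

lemma card_plane_product:
  fixes S T :: "'a::finite set"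
  shows "card (plane_product S T) = card S * card T"
proof -
  have "bij_betw (\<lambda>v. (v $ 1, v $ 2)) (plane_product S T) (S \<times> T)"
    by (rule bij_betw_byWitness[where f' = "\<lambda>(x, y). \<chi> i. if i = 1 then x else y"])
      (auto simp: plane_product_def vec_eq_iff forall_2)
  then show ?thesis
    by (simp add: bij_betw_same_card card_cartesian_product)
qed

text \<open>An invertible matrix has a nonzero diagonal or a nonzero antidiagonal product, and its
  remaining entries may then be replaced by zero.\<close>

lemma GammaL2_plane_product_iff:
  fixes S T S' T' :: "'a::{finite,field} set"
  assumes \<sigma>: "field_automorphism \<sigma>" and zero: "0 \<in> S'" "0 \<in> T'"
    and card: "card S = c" "card T = c" "card S' = c" "card T' = c"
  shows "(\<exists>\<phi>. GammaL2 \<sigma> \<phi> \<and> \<phi> ` plane_product S' T' = plane_product S T) \<longleftrightarrow>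
    (\<exists>\<alpha>. \<alpha> \<noteq> 0 \<and> (*) \<alpha> ` \<sigma> ` S' \<subseteq> S) \<and> (\<exists>\<alpha>. \<alpha> \<noteq> 0 \<and> (*) \<alpha> ` \<sigma> ` T' \<subseteq> T) \<or>
    (\<exists>\<alpha>. \<alpha> \<noteq> 0 \<and> (*) \<alpha> ` \<sigma> ` T' \<subseteq> S) \<and> (\<exists>\<alpha>. \<alpha> \<noteq> 0 \<and> (*) \<alpha> ` \<sigma> ` S' \<subseteq> T)"
    (is "?lhs \<longleftrightarrow> ?rhs")
proof -
  note \<sigma>0 = field_automorphism_simps(1)[OF \<sigma>]
  have inj: "inj \<sigma>"
    using \<sigma> by (simp add: field_automorphism_def bij_is_inj)
  define act where "act M v = M *v (\<chi> i. \<sigma> (v $ i))" for M :: "'a^2^2" and v :: "'a^2"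
  have act_nth: "act M v $ i = M $ i $ 1 * \<sigma> (v $ 1) + M $ i $ 2 * \<sigma> (v $ 2)" for M v i
    by (simp add: act_def matrix_vector_mult_def sum_2)
  have inv_iff: "invertible M \<longleftrightarrow> M $ 1 $ 1 * M $ 2 $ 2 - M $ 1 $ 2 * M $ 2 $ 1 \<noteq> 0" for M :: "'a^2^2"
    by (simp add: invertible_det_nz det_2)
  \<comment> \<open>The map is injective and both products have the same size, so inclusion
    suffices.\<close>
  have image_eq: "act M ` plane_product S' T' = plane_product S T"
    if M: "invertible M" and sub: "act M ` plane_product S' T' \<subseteq> plane_product S T" for M
  proof (rule card_subset_eq[OF _ sub])
    have "inj (act M)"
    proof (rule injI)
      fix v w assume "act M v = act M w"
      then have "(\<chi> i. \<sigma> (v $ i)) = (\<chi> i. \<sigma> (w $ i))"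
        using M unfolding act_def
        by (metis invertible_def matrix_vector_mul_assoc matrix_vector_mul_lid)
      then show "v = w"
        using inj by (simp add: vec_eq_iff inj_eq)
    qed
    then show "card (act M ` plane_product S' T') = card (plane_product S T)"
      by (simp add: card_image inj_on_subset card_plane_product card)
  qed simp
  have "?lhs \<longleftrightarrow> (\<exists>M. invertible M \<and> act M ` plane_product S' T' = plane_product S T)"
    using \<sigma> by (auto simp: GammaL2_def act_def[abs_def])
  also have "\<dots> \<longleftrightarrow> (\<exists>M. invertible M \<and> act M ` plane_product S' T' \<subseteq> plane_product S T)"
    using image_eq by blast
  also have "\<dots> \<longleftrightarrow> ?rhs"
  proof
    assume "\<exists>M. invertible M \<and> act M ` plane_product S' T' \<subseteq> plane_product S T"
    then obtain M where M: "invertible M" and sub: "act M ` plane_product S' T' \<subseteq> plane_product S T"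
      by blast
    \<comment> \<open>Setting \<open>v = 0\<close> or \<open>u = 0\<close> isolates the entries of
      one column of the matrix.\<close>
    have mem: "act M (\<chi> i. if i = 1 then u else v) \<in> plane_product S T" if "u \<in> S'" "v \<in> T'" for u v
      using that by (intro subsetD[OF sub] imageI) (simp add: plane_product_def)
    have "M $ 1 $ 1 * \<sigma> u \<in> S" "M $ 2 $ 1 * \<sigma> u \<in> T" if "u \<in> S'" for u
      using mem[OF that zero(2)] by (simp_all add: plane_product_def act_nth \<sigma>0)
    then have S': "(*) (M $ 1 $ 1) ` \<sigma> ` S' \<subseteq> S" "(*) (M $ 2 $ 1) ` \<sigma> ` S' \<subseteq> T"
      by auto
    have "M $ 1 $ 2 * \<sigma> v \<in> S" "M $ 2 $ 2 * \<sigma> v \<in> T" if "v \<in> T'" for v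
      using mem[OF zero(1) that] by (simp_all add: plane_product_def act_nth \<sigma>0)
    then have T': "(*) (M $ 1 $ 2) ` \<sigma> ` T' \<subseteq> S" "(*) (M $ 2 $ 2) ` \<sigma> ` T' \<subseteq> T"
      by auto
    have "M $ 1 $ 1 \<noteq> 0 \<and> M $ 2 $ 2 \<noteq> 0 \<or> M $ 1 $ 2 \<noteq> 0 \<and> M $ 2 $ 1 \<noteq> 0"
      using M inv_iff by auto
    then show ?rhs
      using S' T' by blast
  next
    assume ?rhs
    then show "\<exists>M. invertible M \<and> act M ` plane_product S' T' \<subseteq> plane_product S T"
    proof (elim disjE conjE exE)
      fix \<alpha> \<beta> assume *: "\<alpha> \<noteq> 0" "(*) \<alpha> ` \<sigma> ` S' \<subseteq> S" "\<beta> \<noteq> 0" "(*) \<beta> ` \<sigma> ` T' \<subseteq> T"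
      let ?M = "vector [vector [\<alpha>, 0], vector [0, \<beta>]] :: 'a^2^2"
      show ?thesis
        using * by (intro exI[of _ ?M]) (auto simp: inv_iff plane_product_def act_nth)
    next
      fix \<alpha> \<beta> assume *: "\<alpha> \<noteq> 0" "(*) \<alpha> ` \<sigma> ` T' \<subseteq> S" "\<beta> \<noteq> 0" "(*) \<beta> ` \<sigma> ` S' \<subseteq> T"
      let ?M = "vector [vector [0, \<alpha>], vector [\<beta>, 0]] :: 'a^2^2"
      show ?thesis
        using * by (intro exI[of _ ?M]) (auto simp: inv_iff plane_product_def act_nth)
    qed
  qed
  finally show ?thesis .
qed

section \<open>From scalar criteria to the conditions (I) and (II)\<close>

theorem theorem4p14:
  fixes \<xi> \<eta> a b \<mu>1 \<mu>2 A B :: "'a::{finite,field}"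
    and \<sigma> :: "'a \<Rightarrow> 'a"
    and q t n s s' :: nat
    and K :: "'a set"
    and N :: "'a \<Rightarrow> 'a"
    and U U' :: "('a^2) set"
  assumes "primepow q" and "t \<ge> 3" and "n = 2 * t" and "CARD('a) = q ^ n"
    and K: "K = subfield_of_order (q ^ t)"
    and N: "N = field_norm q t"
    and "\<xi> \<notin> K" and "\<eta> \<notin> K"
    and "a \<in> K" and "b \<in> K" and "\<xi>^2 = a * \<xi> + b"
    and "\<mu>1 \<in> K" and "\<mu>1 \<noteq> 0" and "\<mu>2 \<in> K" and "\<mu>2 \<noteq> 0"
    and "N \<mu>1 \<noteq> 1" and "N \<mu>2 \<noteq> 1"
    and "N (- (\<xi> ^ (q ^ t + 1) * \<mu>1)) \<noteq> (- 1) ^ t"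
    and "N (- (\<eta> ^ (q ^ t + 1) * \<mu>2)) \<noteq> (- 1) ^ t"
    and "s > 0" and "s' > 0" and "coprime s t" and "coprime s' t"
    and U: "U = plane_product (poly_subspace K (\<lambda>x. x ^ (q ^ s)) \<xi>)
                              (poly_subspace K (\<lambda>x. \<mu>1 * x ^ (q ^ s)) \<xi>)"
    and U': "U' = plane_product (poly_subspace K (\<lambda>x. x ^ (q ^ s')) \<eta>)
                                (poly_subspace K (\<lambda>x. \<mu>2 * x ^ (q ^ s')) \<eta>)"
    and "field_automorphism \<sigma>"
    and "A \<in> K" and "B \<in> K" and "\<sigma> \<eta> = A * \<xi> + B"
  shows "(\<exists>\<phi>. GammaL2 \<sigma> \<phi> \<and> \<phi> ` U' = U) \<longleftrightarrow>
      ([int s = - int s'] (mod int t) \<and> \<xi> = (\<sigma> \<eta> + A * a) / A \<and> B = - (A * a) \<and>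
        ((\<exists>c1\<in>K. \<exists>c2\<in>K. N c1 = 1 \<and> N c2 = 1 \<and>
            \<mu>2 = 1 / (c1 * inv \<sigma> A * inv \<sigma> b) \<and>
            \<mu>1 = 1 / (c2 * A ^ (q ^ s) * b ^ (q ^ s))) \<or>
         (N (A * b) = 1 \<and>
          (\<exists>c\<in>K. N c = 1 \<and> \<mu>2 = 1 / (c * inv \<sigma> (inv (\<lambda>x. x ^ (q ^ s)) \<mu>1))))))
    \<or> ([int s = int s'] (mod int t) \<and> \<xi> = \<sigma> \<eta> / A \<and> B = 0 \<and>
        ((\<exists>c1\<in>K. \<exists>c2\<in>K. N c1 = 1 \<and> N c2 = 1 \<and>
            \<mu>2 = c1 / inv \<sigma> A \<and> \<mu>1 = A / c2) \<or>
         (N A = 1 \<and>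
          (\<exists>c\<in>K. N c = 1 \<and> \<mu>2 = inv \<sigma> \<mu>1 * c / inv \<sigma> A))))"
proof -
  interpret quadratic_tower q t "TYPE('a)"
    using assms by unfold_locales auto
  note aut = field_automorphism_simps[OF \<open>field_automorphism \<sigma>\<close>]
  note inv_aut = field_automorphism_inv[OF \<open>field_automorphism \<sigma>\<close>]
  have \<eta>: "\<sigma> \<eta> \<notin> K"
    using automorphism_in_K[OF inv_aut(1), of "\<sigma> \<eta>"] \<open>\<eta> \<notin> K\<close> inv_aut(2) aut(7) K by metis
  have "A \<noteq> 0"
    using \<eta> \<open>\<sigma> \<eta> = A * \<xi> + B\<close> \<open>B \<in> K\<close> by auto
  \<comment> \<open>With \<open>b = 0\<close>, \<xi> would be \<open>0\<close> or
    \<open>a\<close>.\<close>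
  have "b \<noteq> 0"
    using \<open>\<xi>^2 = a * \<xi> + b\<close> \<open>\<xi> \<notin> K\<close> \<open>a \<in> K\<close> K by (auto simp: power2_eq_square)
  have \<mu>2: "\<sigma> \<mu>2 \<in> K" "\<sigma> \<mu>2 \<noteq> 0"
    using assms automorphism_in_K[OF \<open>field_automorphism \<sigma>\<close>] aut(1,7) by (metis, metis)
  have one_in_K: "1 \<in> K"
    by (simp add: K)
  \<comment> \<open>The criterion of \<open>scale_subset_iff\<close>, as a relation between the
    multipliers of the two sets.\<close>
  define P where "P \<nu>' \<nu> \<longleftrightarrow> (s mod t = s' mod t \<and> B = 0 \<and> N (A * \<nu>') = N \<nu>) \<or>
    ((s + s') mod t = 0 \<and> B = - (A * a) \<and> N \<nu> * N (A * b * \<nu>') = 1)" for \<nu>' \<nu>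
  have scale: "(\<exists>\<alpha>. \<alpha> \<noteq> 0 \<and> (*) \<alpha> ` L \<nu>' s' (\<sigma> \<eta>) \<subseteq> L \<nu> s \<xi>) \<longleftrightarrow> P \<nu>' \<nu>"
    if "\<nu> \<in> K" "\<nu>' \<in> K" "\<nu> \<noteq> 0" "\<nu>' \<noteq> 0" for \<nu> \<nu>'
    unfolding P_def \<open>\<sigma> \<eta> = A * \<xi> + B\<close> N
    using assms that \<open>A \<noteq> 0\<close> by (intro scale_subset_iff) auto
  have "U = plane_product (L 1 s \<xi>) (L \<mu>1 s \<xi>)" "U' = plane_product (L 1 s' \<eta>) (L \<mu>2 s' \<eta>)"
    by (simp_all add: U U' K)
  then have "(\<exists>\<phi>. GammaL2 \<sigma> \<phi> \<and> \<phi> ` U' = U) \<longleftrightarrow>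
      (\<exists>\<alpha>. \<alpha> \<noteq> 0 \<and> (*) \<alpha> ` \<sigma> ` L 1 s' \<eta> \<subseteq> L 1 s \<xi>) \<and>
      (\<exists>\<alpha>. \<alpha> \<noteq> 0 \<and> (*) \<alpha> ` \<sigma> ` L \<mu>2 s' \<eta> \<subseteq> L \<mu>1 s \<xi>) \<or>
      (\<exists>\<alpha>. \<alpha> \<noteq> 0 \<and> (*) \<alpha> ` \<sigma> ` L \<mu>2 s' \<eta> \<subseteq> L 1 s \<xi>) \<and>
      (\<exists>\<alpha>. \<alpha> \<noteq> 0 \<and> (*) \<alpha> ` \<sigma> ` L 1 s' \<eta> \<subseteq> L \<mu>1 s \<xi>)"
    by (simp only:) (rule GammaL2_plane_product_iff[OF \<open>field_automorphism \<sigma>\<close>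
      zero_in_L zero_in_L card_L card_L card_L card_L]; use assms in simp)
  also have "\<dots> \<longleftrightarrow> P 1 1 \<and> P (\<sigma> \<mu>2) \<mu>1 \<or> P (\<sigma> \<mu>2) 1 \<and> P 1 \<mu>1"
    using \<open>\<mu>1 \<in> K\<close> \<open>\<mu>1 \<noteq> 0\<close> \<mu>2 one_in_K
    by (simp only: automorphism_image_L[OF \<open>field_automorphism \<sigma>\<close>] aut(2) scale one_neq_zero
        not_False_eq_True)
  \<comment> \<open>Matching the factors in order leads to (I.2) and (II.2), matching them crosswise
    to (I.1) and (II.1).\<close>
  finally have equiv: "(\<exists>\<phi>. GammaL2 \<sigma> \<phi> \<and> \<phi> ` U' = U) \<longleftrightarrow>
    P 1 1 \<and> P (\<sigma> \<mu>2) \<mu>1 \<or> P (\<sigma> \<mu>2) 1 \<and> P 1 \<mu>1" .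

  have norm_\<sigma>: "N x = N y \<longleftrightarrow> N (\<sigma> x) = N (\<sigma> y)" for x y
    by (simp add: N norm_automorphism[OF \<open>field_automorphism \<sigma>\<close>] aut(7))
  have inv_K: "inv \<sigma> x \<in> K" if "x \<in> K" for x
    using automorphism_in_K[OF inv_aut(1)] that K by simp
  have inv_nz: "inv \<sigma> x \<noteq> 0" if "x \<noteq> 0" for x
    using that inv_aut(2) aut(1) by metis
  let ?r = "inv (\<lambda>x. x ^ (q ^ s)) \<mu>1"
  have r: "?r \<in> K" "?r \<noteq> 0" "N ?r = N \<mu>1"
    using frobenius_root_in_K[of \<mu>1 s] norm_frobenius[of ?r s] \<open>\<mu>1 \<in> K\<close> \<open>\<mu>1 \<noteq> 0\<close> q_gt_1
    by (auto simp: K N power_0_left)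
  note nz = \<open>A \<noteq> 0\<close> \<open>b \<noteq> 0\<close> \<open>\<mu>1 \<noteq> 0\<close> \<open>\<mu>2 \<noteq> 0\<close>
  note in_K = \<open>A \<in> K\<close> \<open>b \<in> K\<close> \<open>\<mu>1 \<in> K\<close> \<open>\<mu>2 \<in> K\<close>
  \<comment> \<open>The existential conditions become norm equations: applying \<sigma> removes its
    inverse, and Frobenius powers and roots preserve norms.\<close>
  have I1: "(\<exists>c\<in>K. N c = 1 \<and> \<mu>2 = 1 / (c * inv \<sigma> A * inv \<sigma> b)) \<longleftrightarrow> N (\<sigma> \<mu>2) = 1 / (N A * N b)"
    using norm_eq_iff_divide[of \<mu>2 "1 / (inv \<sigma> A * inv \<sigma> b)"]
      norm_\<sigma>[of \<mu>2 "1 / (inv \<sigma> A * inv \<sigma> b)"] in_K nz inv_K inv_nz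
    by (simp add: K N K_divide K_mult aut inv_aut(2) norm_divide norm_mult mult_ac)
  have I1': "(\<exists>c\<in>K. N c = 1 \<and> \<mu>1 = 1 / (c * A ^ (q ^ s) * b ^ (q ^ s))) \<longleftrightarrow> N \<mu>1 = 1 / (N A * N b)"
    using norm_eq_iff_divide[of \<mu>1 "1 / (A ^ (q ^ s) * b ^ (q ^ s))"] in_K nz
    by (simp add: K N K_divide K_mult K_power norm_divide norm_mult norm_frobenius mult_ac)
  have I2: "(\<exists>c\<in>K. N c = 1 \<and> \<mu>2 = 1 / (c * inv \<sigma> ?r)) \<longleftrightarrow> N (\<sigma> \<mu>2) = 1 / N \<mu>1"
    using norm_eq_iff_divide[of \<mu>2 "1 / inv \<sigma> ?r"] norm_\<sigma>[of \<mu>2 "1 / inv \<sigma> ?r"]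
      in_K nz r inv_K[of ?r] inv_nz[of ?r]
    by (simp add: K N K_divide aut inv_aut(2) norm_divide mult_ac)
  have II1: "(\<exists>c\<in>K. N c = 1 \<and> \<mu>2 = c / inv \<sigma> A) \<longleftrightarrow> N (\<sigma> \<mu>2) = 1 / N A"
    using norm_eq_iff[of \<mu>2 "1 / inv \<sigma> A"] norm_\<sigma>[of \<mu>2 "1 / inv \<sigma> A"] in_K nz inv_K inv_nz
    by (simp add: K N K_divide aut inv_aut(2) norm_divide)
  have II1': "(\<exists>c\<in>K. N c = 1 \<and> \<mu>1 = A / c) \<longleftrightarrow> N \<mu>1 = N A"
    using norm_eq_iff_divide[of \<mu>1 A] in_K nz by (simp add: K N)
  have II2: "(\<exists>c\<in>K. N c = 1 \<and> \<mu>2 = inv \<sigma> \<mu>1 * c / inv \<sigma> A) \<longleftrightarrow> N (\<sigma> \<mu>2) = N \<mu>1 / N A"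
    using norm_eq_iff[of \<mu>2 "inv \<sigma> \<mu>1 / inv \<sigma> A"] norm_\<sigma>[of \<mu>2 "inv \<sigma> \<mu>1 / inv \<sigma> A"]
      in_K nz inv_K inv_nz
    by (simp add: K N K_divide aut inv_aut(2) norm_divide mult_ac)

  have cong: "[int s = int s'] (mod int t) \<longleftrightarrow> s mod t = s' mod t"
    using cong_int_iff[of s s' t] by (simp only: cong_def)
  have "int s - - int s' = int (s + s')"
    by simp
  then have cong': "[int s = - int s'] (mod int t) \<longleftrightarrow> (s + s') mod t = 0"
    by (simp only: cong_iff_dvd_diff of_nat_dvd_iff mod_eq_0_iff_dvd)
  have \<xi>: "\<xi> = (\<sigma> \<eta> + A * a) / A \<and> B = - (A * a) \<longleftrightarrow> B = - (A * a)"
    "\<xi> = \<sigma> \<eta> / A \<and> B = 0 \<longleftrightarrow> B = 0"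
    using \<open>A \<noteq> 0\<close> by (auto simp: \<open>\<sigma> \<eta> = A * \<xi> + B\<close>)
  have split: "(\<exists>c1\<in>K. \<exists>c2\<in>K. N c1 = 1 \<and> N c2 = 1 \<and> Q c1 \<and> R c2) \<longleftrightarrow>
    (\<exists>c\<in>K. N c = 1 \<and> Q c) \<and> (\<exists>c\<in>K. N c = 1 \<and> R c)" for Q R
    by blast
  have N_nz: "N A \<noteq> 0" "N b \<noteq> 0" "N \<mu>1 \<noteq> 0"
    using nz by (simp_all add: N)
  have N_mult: "N (x * y) = N x * N y" "N 1 = 1" for x y
    by (simp_all add: N norm_mult)
  \<comment> \<open>Rules out that one factor is matched by the first alternative of
    \<open>P\<close> and the other by the second.\<close>
  have excl: "\<not> (s mod t = s' mod t \<and> (s + s') mod t = 0)"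
    using add_mod_ne_0[OF \<open>t \<ge> 3\<close> \<open>coprime s t\<close>, of s'] by argo
  have div_iff: "m = k / X \<longleftrightarrow> X * m = k" if "X \<noteq> 0" for X m k :: 'a
    using that by (simp add: eq_divide_eq mult.commute)
  \<comment> \<open>\<open>X\<close> stands for \<open>N A\<close>, and in \<open>opposite\<close>
    for \<open>N A * N b\<close>; \<open>m1\<close> and \<open>m2\<close> stand for the norms of
    \<open>\<mu>1\<close> and \<open>\<sigma> \<mu>2\<close>.\<close>
  have same: "(X = 1 \<and> X * m2 = m1) \<or> (X * m2 = 1 \<and> X = m1) \<longleftrightarrow>
      (m2 = 1 / X \<and> m1 = X) \<or> (X = 1 \<and> m2 = m1 / X)" if "X \<noteq> 0" for X m1 m2 :: 'a
    unfolding div_iff[OF that] eq_commute[of m1 X] by argo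
  have opposite: "(X = 1 \<and> m1 * (X * m2) = 1) \<or> (X * m2 = 1 \<and> m1 * X = 1) \<longleftrightarrow>
      (m2 = 1 / X \<and> m1 = 1 / X) \<or> (X = 1 \<and> m2 = 1 / m1)"
    if "X \<noteq> 0" "m1 \<noteq> 0" for X m1 m2 :: 'a
    unfolding div_iff[OF that(1)] div_iff[OF that(2)] mult.commute[of m1 X]
    by (cases "X = 1") (simp_all add: disj_commute)
  have "N A * N b \<noteq> 0"
    using N_nz by simp
  \<comment> \<open>With every condition written as a congruence, a value of \<open>B\<close> or a
    norm equation, the rest is propositional.\<close>
  show ?thesis
    unfolding equiv P_def cong cong' split I1 I1' I2 II1 II1' II2 N_mult mult_1_left mult_1_right
    using excl \<xi> same[OF N_nz(1), where ?m1.0 = "N \<mu>1" and ?m2.0 = "N (\<sigma> \<mu>2)"]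
      opposite[OF \<open>N A * N b \<noteq> 0\<close> N_nz(3), where ?m2.0 = "N (\<sigma> \<mu>2)"]
    by satx
qed

end
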